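(* Let $U$, $(U_j)_{j\ge1}$ be i.i.d. uniform $[0,1]$ random variables and $(E_j)_{j\ge1}$ i.i.d. standard exponential random variables, all independent. For $k\ge1$ let $$B_k=\Big(\frac{E_1}{U}+\frac{E_2}{U\,U_1}+\dots+\frac{E_k}{U\,U_1\cdots U_{k-1}}\Big)\big(1-U\,U_1\cdots U_k\big).$$ Then for every integer $k\ge1$ and every $s>0$, $$P(B_k>s)=-I_2(s)\int_0^s \xi\,e^{\xi}\,q_{k-1}(\xi)\,d\xi+\sum_{j=0}^{k-1}q_j(s).$$
   Context: $\sigma_1(k,j)$ are the unsigned Stirling numbers of the first kind ($\sigma_1(k,j)=0$ for $k<j$, $\sigma_1(0,0)=1$); $p_j(t)=e^{-t}\sum_{k=j}^\infty \frac{t^k}{k!}\frac{\sigma_1(k,j)}{k!}$; $q_j(t)=\frac1t\int_0^t p_j(u)\,du$ (so $q_0(t)=(1-e^{-t})/t$); $I_2(s)=\int_s^\infty\frac{e^{-\xi}}{\xi^2}\,d\xi$. *)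

theory Defs
  imports "HOL-Probability.Probability" "HOL-Combinatorics.Stirling"
begin

definition p_fun :: "nat \<Rightarrow> real \<Rightarrow> real" where
  "p_fun j t = exp (- t) * (\<Sum>k. t ^ k / fact k * real (stirling k j) / fact k)"

definition q_fun :: "nat \<Rightarrow> real \<Rightarrow> real" where
  "q_fun j t = (1 / t) * integral {0..t} (p_fun j)"

definition I2 :: "real \<Rightarrow> real" where
  "I2 s = integral {s..} (\<lambda>\<xi>. exp (- \<xi>) / \<xi>\<^sup>2)"

text \<open>U 0 is U, U j (j \<ge> 1) is U_j; E j (j \<ge> 1) is E_j.\<close>
definition B_var :: "(nat \<Rightarrow> 'a \<Rightarrow> real) \<Rightarrow> (nat \<Rightarrow> 'a \<Rightarrow> real) \<Rightarrow> nat \<Rightarrow> 'a \<Rightarrow> real" where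
  "B_var U E k \<omega> = (\<Sum>i=1..k. E i \<omega> / (\<Prod>m=0..<i. U m \<omega>)) * (1 - (\<Prod>m=0..k. U m \<omega>))"

end

theory Submission
  imports Defs
begin

text \<open>
  Let \<open>W\<^sub>i = U U\<^sub>1 \<dots> U\<^sub>i\<^sub>-\<^sub>1\<close> and \<open>S\<^sub>k = E\<^sub>1 / W\<^sub>1 + \<dots> + E\<^sub>k / W\<^sub>k\<close>, so that
  \<open>B\<^sub>k = S\<^sub>k (1 - W\<^sub>k\<^sub>+\<^sub>1)\<close>. The pair \<open>(S\<^sub>k, W\<^sub>k\<^sub>+\<^sub>1)\<close> is the time and value of the \<open>k\<close>-th record after
  time \<open>0\<close> (new minimum) of uniform marks arriving at rate \<open>1\<close>. Counting records with Stirling numbers gives the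
  joint density \<open>(1 - w) e\<^sup>-\<^sup>t g\<^sub>k (t (1 - w))\<close>, where \<open>g\<^sub>k\<close> (\<open>stir_deriv\<close>) is the derivative of
  \<open>P\<^sub>k(x) = e\<^sup>x p\<^sub>k(x)\<close> (\<open>stir_series\<close>); this is proved by induction on \<open>k\<close> along the Markov chain, using the differential equation
  \<open>(x g\<^sub>k\<^sub>+\<^sub>1)' = x g\<^sub>k\<^sub>+\<^sub>1 + P\<^sub>k\<close>. Since \<open>\<integral>\<^sub>0\<^sup>1 e\<^sup>-\<^sup>x\<^sup>/\<^sup>v dv = x I\<^sub>2(x)\<close>, integrating out \<open>w\<close>
  gives \<open>P(B\<^sub>k \<le> s) = \<integral>\<^sub>0\<^sup>s x I\<^sub>2(x) g\<^sub>k(x) dx\<close>. The claimed right-hand side has derivative \<open>- s I\<^sub>2(s) g\<^sub>k(s)\<close>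
  and tends to \<open>1\<close> as \<open>s\<close> tends to \<open>0\<close>.
\<close>

section \<open>Power series with Stirling number coefficients\<close>

text \<open>\<open>p_fun k\<close> without its factor \<open>exp (- t)\<close>, written as
  coefficient times power so that termwise differentiation applies.\<close>

definition stir_series :: "nat \<Rightarrow> real \<Rightarrow> real" where
  "stir_series k x = (\<Sum>n. real (stirling n k) / (fact n)\<^sup>2 * x ^ n)"

definition stir_deriv :: "nat \<Rightarrow> real \<Rightarrow> real" where
  "stir_deriv k x = (\<Sum>n. real (stirling (Suc n) k) / (fact n * fact (Suc n)) * x ^ n)"

text \<open>Row \<open>n\<close> of the Stirling triangle sums to \<open>fact n\<close>. The bound
  makes the series below converge on the whole real line.\<close>

lemma stirling_le_fact: "stirling n k \<le> fact n"
proof (cases "k \<le> n")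
  case True
  then have "stirling n k \<le> (\<Sum>k\<le>n. stirling n k)"
    by (intro member_le_sum) auto
  then show ?thesis by (simp add: sum_stirling)
qed simp

lemma summable_stir_series: "summable (\<lambda>n. real (stirling n k) / (fact n)\<^sup>2 * x ^ n)"
proof (rule summable_comparison_test')
  show "summable (\<lambda>n. inverse (fact n) * \<bar>x\<bar> ^ n)"
    by (rule summable_exp)
  have "real (stirling n k) / (fact n)\<^sup>2 \<le> inverse (fact n)" for n
  proof -
    have "real (stirling n k) \<le> fact n"
      using stirling_le_fact[of n k] by (metis of_nat_fact of_nat_le_iff)
    then show ?thesis by (simp add: divide_simps power2_eq_square)
  qed
  then show "norm (real (stirling n k) / (fact n)\<^sup>2 * x ^ n) \<le> inverse (fact n) * \<bar>x\<bar> ^ n"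
    if "n \<ge> 0" for n
    by (simp add: abs_mult power_abs mult_right_mono del: times_divide_eq_left)
qed

lemma diffs_stir:
  "diffs (\<lambda>n. real (stirling n k) / (fact n)\<^sup>2) n = real (stirling (Suc n) k) / (fact n * fact (Suc n))"
proof -
  have "(fact (Suc n) :: real) = real (Suc n) * fact n" by (rule fact_Suc)
  then show ?thesis by (simp add: diffs_def power2_eq_square del: fact_Suc)
qed

lemma summable_stir_deriv:
  "summable (\<lambda>n. real (stirling (Suc n) k) / (fact n * fact (Suc n)) * x ^ n)"
  using termdiff_converges_all[OF summable_stir_series, of k x] unfolding diffs_stir .

lemma DERIV_stir_series: "(stir_series k has_real_derivative stir_deriv k x) (at x)"
  using termdiffs_strong_converges_everywhere[OF summable_stir_series, of k x]
  unfolding diffs_stir stir_series_def[abs_def] stir_deriv_def .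

lemma stir_series_0: "stir_series k 0 = (if k = 0 then 1 else 0)"
  unfolding stir_series_def powser_zero by (cases k) auto

lemma stir_deriv_0: "stir_deriv k 0 = (if k = 1 then 1 else 0)"
  unfolding stir_deriv_def powser_zero by (cases k; cases "k - 1") auto

lemma stir_series_nonneg: "x \<ge> 0 \<Longrightarrow> stir_series k x \<ge> 0"
  unfolding stir_series_def by (intro suminf_nonneg summable_stir_series) auto

lemma stir_deriv_nonneg: "x \<ge> 0 \<Longrightarrow> stir_deriv k x \<ge> 0"
  unfolding stir_deriv_def by (intro suminf_nonneg summable_stir_deriv) auto

lemma isCont_stir_deriv: "isCont (stir_deriv k) x"
  unfolding stir_deriv_def[abs_def]
  by (intro isCont_powser_converges_everywhere summable_stir_deriv)

lemma isCont_stir_series: "isCont (stir_series k) x"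
  using DERIV_stir_series by (rule DERIV_isCont)

lemma stir_deriv_index_0: "stir_deriv 0 x = 0"
  unfolding stir_deriv_def by simp

text \<open>Multiplication by \<open>x\<close> shifts the index, so that the coefficients involve
  \<open>stirling n k\<close> as in \<open>stir_series\<close> and the Stirling recurrence can be
  applied coefficientwise.\<close>

lemma mult_stir_deriv:
  "x * stir_deriv k x = (\<Sum>n. real n * real (stirling n k) / (fact n)\<^sup>2 * x ^ n)"
  and summable_mult_stir_deriv: "summable (\<lambda>n. real n * real (stirling n k) / (fact n)\<^sup>2 * x ^ n)"
proof -
  let ?f = "\<lambda>n. real n * real (stirling n k) / (fact n)\<^sup>2 * x ^ n"
  have eq: "?f (Suc n) = real (stirling (Suc n) k) / (fact n * fact (Suc n)) * x ^ n * x" for n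
  proof -
    have "(fact (Suc n) :: real) = real (Suc n) * fact n" by (rule fact_Suc)
    then show ?thesis by (simp add: power2_eq_square del: fact_Suc)
  qed
  have "(\<lambda>n. ?f (Suc n)) sums (stir_deriv k x * x)"
    unfolding eq stir_deriv_def by (intro sums_mult2 summable_sums summable_stir_deriv)
  then have "?f sums (stir_deriv k x * x)"
    by (subst (asm) sums_Suc_iff) simp
  then show "x * stir_deriv k x = suminf ?f" "summable ?f"
    by (auto simp: sums_iff mult.commute)
qed

text \<open>This is the Stirling recurrence \<open>stirling (n+1) (k+1) = n * stirling n (k+1) + stirling n k\<close>,
  divided by \<open>(n!)\<^sup>2\<close>.\<close>
lemma DERIV_mult_stir_deriv:
  "((\<lambda>x. x * stir_deriv (Suc k) x) has_real_derivative
     x * stir_deriv (Suc k) x + stir_series k x) (at x)"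
proof -
  let ?c = "\<lambda>n. real n * real (stirling n (Suc k)) / (fact n)\<^sup>2"
  have d: "diffs ?c n = real n * real (stirling n (Suc k)) / (fact n)\<^sup>2
      + real (stirling n k) / (fact n)\<^sup>2" for n
  proof -
    have "(fact (Suc n) :: real) = real (Suc n) * fact n" by (rule fact_Suc)
    then have "diffs ?c n = real (stirling (Suc n) (Suc k)) / (fact n)\<^sup>2"
      by (simp add: diffs_def power2_eq_square del: fact_Suc stirling.simps of_nat_Suc)
    then show ?thesis by (simp add: add_divide_distrib)
  qed
  have "((\<lambda>x. \<Sum>n. ?c n * x ^ n) has_real_derivative (\<Sum>n. diffs ?c n * x ^ n)) (at x)"
    by (rule termdiffs_strong_converges_everywhere) (rule summable_mult_stir_deriv)
  also have "(\<Sum>n. diffs ?c n * x ^ n) = x * stir_deriv (Suc k) x + stir_series k x"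
    unfolding d distrib_right mult_stir_deriv stir_series_def
    by (rule suminf_add[symmetric, OF summable_mult_stir_deriv summable_stir_series])
  finally show ?thesis unfolding mult_stir_deriv .
qed

text \<open>Since \<open>stirling (Suc n) 1 = fact n\<close>, this is the exponential series without
  its constant term. It yields the density for \<open>k = 1\<close>.\<close>

lemma mult_stir_deriv_1: "x * stir_deriv 1 x = exp x - 1"
proof -
  let ?f = "\<lambda>n. real n * real (stirling n 1) / (fact n)\<^sup>2 * x ^ n"
  have "?f (Suc n) = x ^ Suc n / fact (Suc n)" for n
  proof -
    have "(fact (Suc n) :: real) = real (Suc n) * fact n" by (rule fact_Suc)
    then show ?thesis
      by (simp add: stirling_Suc_n_1 power2_eq_square del: fact_Suc stirling.simps of_nat_Suc power_Suc)
  qed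
  moreover have "(\<lambda>n. x ^ n / fact n) sums exp x"
    using exp_converges[of x] by (simp add: divide_inverse mult.commute)
  then have "(\<lambda>n. x ^ Suc n / fact (Suc n)) sums (exp x - 1)"
    by (subst sums_Suc_iff) simp
  ultimately have "(\<lambda>n. ?f (Suc n)) sums (exp x - 1)" by simp
  then have "?f sums (exp x - 1)"
    by (subst (asm) sums_Suc_iff) simp
  then show ?thesis
    using mult_stir_deriv[of x 1] by (simp add: sums_iff)
qed

section \<open>Closed forms of \<open>p_fun\<close>, \<open>q_fun\<close> and the integral in the
  claim\<close>

lemma p_fun_eq: "p_fun k x = exp (- x) * stir_series k x"
  unfolding p_fun_def stir_series_def by (simp add: power2_eq_square field_simps)

text \<open>In the product rule the terms with \<open>x * stir_deriv (Suc k) x\<close> cancel. This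
  is the antiderivative of \<open>p_fun k\<close> that vanishes at 0.\<close>

lemma DERIV_exp_mult_stir_deriv:
  "((\<lambda>x. exp (- x) * (x * stir_deriv (Suc k) x)) has_real_derivative p_fun k x) (at x)"
proof -
  have "((\<lambda>x. exp (- x)) has_real_derivative - exp (- x)) (at x)"
    by (auto intro!: derivative_eq_intros)
  from DERIV_mult[OF this DERIV_mult_stir_deriv] show ?thesis
    by (rule DERIV_cong) (simp add: p_fun_eq algebra_simps)
qed

text \<open>The factor \<open>t\<close> of the antiderivative in
  \<open>DERIV_exp_mult_stir_deriv\<close> cancels the \<open>1 / t\<close>. At \<open>t = 0\<close>
  the equation fails for \<open>k = 0\<close>, because division by 0 makes
  \<open>q_fun 0 0 = 0\<close>.\<close>

lemma q_fun_eq: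
  assumes "t > 0"
  shows "q_fun k t = exp (- t) * stir_deriv (Suc k) t"
proof -
  have "(p_fun k has_integral (exp (- t) * (t * stir_deriv (Suc k) t) - 0)) {0..t}"
    using assms fundamental_theorem_of_calculus[of 0 t "\<lambda>x. exp (- x) * (x * stir_deriv (Suc k) x)" "p_fun k"]
      DERIV_exp_mult_stir_deriv
    by (auto simp flip: has_real_derivative_iff_has_vector_derivative intro: DERIV_subset)
  then show ?thesis
    using assms by (simp add: q_fun_def integral_unique)
qed

text \<open>Closed form of the integral in the claim, by \<open>integral_q_fun\<close>.\<close>

definition q_moment :: "nat \<Rightarrow> real \<Rightarrow> real" where
  "q_moment k s = (\<Sum>j<k. s * stir_deriv (Suc j) s - s * stir_series j s)"

text \<open>By \<open>DERIV_mult_stir_deriv\<close> each summand has derivative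
  \<open>s * stir_deriv (Suc j) s - s * stir_deriv j s\<close>, since the terms
  \<open>stir_series j s\<close> cancel. The sum telescopes, and \<open>stir_deriv 0\<close> is
  0.\<close>

lemma DERIV_q_moment: "(q_moment k has_real_derivative s * stir_deriv k s) (at s)"
proof -
  have "(q_moment k has_real_derivative (\<Sum>j<k. s * stir_deriv (Suc j) s - s * stir_deriv j s)) (at s)"
    unfolding q_moment_def[abs_def]
    by (intro DERIV_sum)
      (auto intro!: derivative_eq_intros DERIV_mult_stir_deriv[THEN DERIV_cong] DERIV_stir_series)
  also have "(\<Sum>j<k. s * stir_deriv (Suc j) s - s * stir_deriv j s) = s * stir_deriv k s"
    by (subst sum_lessThan_telescope) (simp add: stir_deriv_index_0)
  finally show ?thesis .
qed

lemma integral_q_fun: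
  assumes "s > 0" "k \<ge> 1"
  shows "integral {0..s} (\<lambda>x. x * exp x * q_fun (k - 1) x) = q_moment k s"
proof -
  have "((\<lambda>x. x * stir_deriv k x) has_integral (q_moment k s - q_moment k 0)) {0..s}"
    using assms fundamental_theorem_of_calculus[of 0 s "q_moment k" "\<lambda>x. x * stir_deriv k x"] DERIV_q_moment
    by (auto simp flip: has_real_derivative_iff_has_vector_derivative intro: DERIV_subset)
  \<comment> \<open>\<open>q_fun_eq\<close> requires \<open>x > 0\<close>; at \<open>x = 0\<close>
    the factor \<open>x\<close> makes both sides vanish.\<close>
  moreover have "x * exp x * q_fun (k - 1) x = x * stir_deriv k x" if "x \<in> {0..s}" for x
    using that assms by (cases "x = 0") (auto simp: q_fun_eq exp_minus)
  ultimately have "((\<lambda>x. x * exp x * q_fun (k - 1) x) has_integral q_moment k s) {0..s}"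
    by (subst has_integral_cong[where g="\<lambda>x. x * stir_deriv k x"]) (auto simp: q_moment_def)
  then show ?thesis by (rule integral_unique)
qed

section \<open>The integral \<open>I2\<close>\<close>

text \<open>Integrability and the upper bound follow by comparison with \<open>1 / x ^ 2\<close>,
  whose integral over \<open>{a..}\<close> is \<open>1 / a\<close>.\<close>

lemma integrable_exp_div_square:
  assumes "a > 0"
  shows "(\<lambda>x::real. exp (- x) / x\<^sup>2) integrable_on {a..}"
    and I2_le_inverse: "I2 a \<le> 1 / a" and I2_nonneg: "I2 a \<ge> 0"
proof -
  have i: "((\<lambda>x. 1 / x ^ 2) has_integral 1 / a) {a..}"
    using has_integral_inverse_power_to_inf[of 2 a] assms by simp
  have bnd: "exp (- x) / x\<^sup>2 \<le> 1 / x ^ 2" if "x \<ge> a" for x :: real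
    using that assms by (intro divide_right_mono) auto
  show int: "(\<lambda>x::real. exp (- x) / x\<^sup>2) integrable_on {a..}"
  proof (rule measurable_bounded_by_integrable_imp_integrable_real)
    show "(\<lambda>x::real. exp (- x) / x\<^sup>2) \<in> borel_measurable (lebesgue_on {a..})"
      by (intro measurable_completion borel_measurable_if_lebesgue_on measurable_restrict_space1) 
         measurable
  qed (use i bnd in auto)
  show "I2 a \<le> 1 / a"
    unfolding I2_def using integral_le[OF int has_integral_integrable[OF i]] bnd integral_unique[OF i]
    by auto
  show "I2 a \<ge> 0"
    unfolding I2_def by (rule Henstock_Kurzweil_Integration.integral_nonneg[OF int]) auto
qed

lemma DERIV_I2:
  assumes "s > 0"
  shows "(I2 has_real_derivative - (exp (- s) / s\<^sup>2)) (at s)"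
proof -
  let ?f = "\<lambda>x::real. exp (- x) / x\<^sup>2"
  \<comment> \<open>A window around \<open>s\<close>: \<open>a\<close> keeps away from the
    singularity at 0, and the improper integral is cut at the fixed point \<open>b\<close>, so that
    only a proper integral depends on \<open>x\<close>.\<close>
  define a b where "a = s / 2" and "b = s + 1"
  have a: "0 < a" "a < s" "s < b" using assms by (auto simp: a_def b_def)
  have eq: "I2 x = integral {x..b} ?f + I2 b" if "x \<in> {a<..<b}" for x
    unfolding I2_def
  proof (rule integral_unique)
    have "(?f has_integral (integral {x..b} ?f + integral {b..} ?f)) ({x..b} \<union> {b..})"
      using a that
      by (intro has_integral_Un integrable_integral integrable_exp_div_square(1)
          integrable_continuous_real continuous_intros)
         (auto intro: negligible_subset[of "{b}"])
    also have "{x..b} \<union> {b..} = {x..}" using that by auto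
    finally show "(?f has_integral (integral {x..b} ?f + integral {b..} ?f)) {x..}" .
  qed
  have "((\<lambda>x. integral {x..b} ?f + I2 b) has_real_derivative - ?f s + 0) (at s within {a..b})"
    using a by (intro DERIV_add integral_has_real_derivative' continuous_intros) auto
  then have "((\<lambda>x. integral {x..b} ?f + I2 b) has_real_derivative - ?f s) (at s)"
    using a by (simp add: at_within_Icc_at)
  then show ?thesis
    by (rule has_field_derivative_transform_within_open[where S="{a<..<b}"]) (use a eq in auto)
qed

section \<open>The right-hand side as a function of \<open>s\<close>\<close>

text \<open>The right-hand side of the theorem (see \<open>tail_fun_eq\<close>) in terms of
  functions with known derivatives.\<close>

definition tail_fun :: "nat \<Rightarrow> real \<Rightarrow> real" where
  "tail_fun k s = - I2 s * q_moment k s + (\<Sum>j<k. exp (- s) * stir_deriv (Suc j) s)"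

text \<open>Differentiating \<open>I2\<close> and differentiating the sum give
  \<open>exp (- s) / s ^ 2 * q_moment k s\<close> with opposite signs, so only the term with the
  derivative of \<open>q_moment\<close> survives.\<close>

lemma DERIV_tail_fun:
  assumes s: "s > 0"
  shows "(tail_fun k has_real_derivative - (s * I2 s * stir_deriv k s)) (at s)"
proof -
  \<comment> \<open>The derivative at hand is that of \<open>s * stir_deriv (Suc j) s\<close> times
    \<open>exp (- s)\<close>, hence the detour through a quotient by \<open>s\<close>.\<close>
  have 1: "((\<lambda>s. exp (- s) * (s * stir_deriv (Suc j) s) / s) has_real_derivative
     exp (- s) / s\<^sup>2 * (s * stir_series j s - s * stir_deriv (Suc j) s)) (at s)" for j
    by (rule DERIV_cong[OF DERIV_divide[OF DERIV_exp_mult_stir_deriv DERIV_ident]])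
      (use s in \<open>auto simp: p_fun_eq power2_eq_square field_simps\<close>)
  have 2: "((\<lambda>s. exp (- s) * stir_deriv (Suc j) s) has_real_derivative
     exp (- s) / s\<^sup>2 * (s * stir_series j s - s * stir_deriv (Suc j) s)) (at s)" for j
    by (rule has_field_derivative_transform_within_open[OF 1, where S="{0<..}"]) (use s in auto)
  have "(tail_fun k has_real_derivative (exp (- s) / s\<^sup>2) * q_moment k s - I2 s * (s * stir_deriv k s)
     + (\<Sum>j<k. exp (- s) / s\<^sup>2 * (s * stir_series j s - s * stir_deriv (Suc j) s))) (at s)"
    unfolding tail_fun_def[abs_def]
    by (rule derivative_eq_intros DERIV_I2 DERIV_q_moment DERIV_sum 2 s refl)+ simp
  also have "(\<Sum>j<k. exp (- s) / s\<^sup>2 * (s * stir_series j s - s * stir_deriv (Suc j) s))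
      = - ((exp (- s) / s\<^sup>2) * q_moment k s)"
    unfolding q_moment_def sum_distrib_left sum_negf[symmetric]
    by (intro sum.cong) (auto simp: algebra_simps)
  finally show ?thesis by (simp add: mult_ac)
qed

text \<open>\<open>I2 s\<close> blows up at 0 no faster than \<open>1 / s\<close>, while
  \<open>q_moment k s / s\<close> tends to 0. In the remaining sum only
  \<open>stir_deriv 1 0 = 1\<close> contributes.\<close>

lemma tail_fun_tendsto_1:
  assumes k: "k \<ge> 1"
  shows "(tail_fun k \<longlongrightarrow> 1) (at_right 0)"
proof -
  \<comment> \<open>For \<open>s > 0\<close> this is \<open>q_moment k s / s\<close>. It vanishes at
    0 because both sums equal 1 there.\<close>
  define D where "D = (\<lambda>s. (\<Sum>j<k. stir_deriv (Suc j) s - stir_series j s))"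
  have sd: "(\<Sum>j<k. stir_deriv (Suc j) 0) = 1" "(\<Sum>j<k. stir_series j 0) = 1"
    using k by (simp_all add: stir_deriv_0 stir_series_0)
  have "isCont D 0"
    unfolding D_def by (intro continuous_intros isCont_stir_deriv isCont_stir_series)
  moreover have "D 0 = 0"
    using sd by (simp add: D_def sum_subtractf)
  ultimately have D: "(D \<longlongrightarrow> 0) (at_right 0)"
    by (metis filterlim_at_split isCont_def)
  have I: "((\<lambda>s. - I2 s * q_moment k s) \<longlongrightarrow> 0) (at_right 0)"
  proof (rule Lim_null_comparison)
    show "((\<lambda>s. \<bar>D s\<bar>) \<longlongrightarrow> 0) (at_right 0)"
      using tendsto_rabs[OF D] by simp
    have "norm (- I2 s * q_moment k s) \<le> \<bar>D s\<bar>" if "s > 0" for s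
    proof -
      have "q_moment k s = s * D s"
        by (simp add: q_moment_def D_def sum_distrib_left right_diff_distrib)
      then have "norm (- I2 s * q_moment k s) = (s * I2 s) * \<bar>D s\<bar>"
        using that I2_nonneg[OF that] by (simp add: abs_mult)
      also have "\<dots> \<le> 1 * \<bar>D s\<bar>"
        using that I2_le_inverse[OF that]
        by (intro mult_right_mono) (auto simp: field_simps)
      finally show ?thesis by simp
    qed
    then show "\<forall>\<^sub>F s in at_right 0. norm (- I2 s * q_moment k s) \<le> \<bar>D s\<bar>"
      by (auto simp: eventually_at_right_field intro!: exI[of _ 1])
  qed
  have "isCont (\<lambda>s. \<Sum>j<k. exp (- s) * stir_deriv (Suc j) s) 0"
    by (intro continuous_intros isCont_stir_deriv)
  then have "((\<lambda>s. \<Sum>j<k. exp (- s) * stir_deriv (Suc j) s) \<longlongrightarrow> 1) (at_right 0)"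
    using sd by (simp add: isCont_def filterlim_at_split)
  from tendsto_add[OF I this] show ?thesis
    unfolding tail_fun_def[abs_def] by simp
qed

section \<open>Nonnegative integrals by antiderivatives\<close>

lemma borel_measurable_lborel_pair:
  assumes "f \<in> borel_measurable (borel \<Otimes>\<^sub>M borel)"
  shows "f \<in> borel_measurable (lborel \<Otimes>\<^sub>M lborel)"
proof -
  have "sets (borel \<Otimes>\<^sub>M borel) = sets (lborel \<Otimes>\<^sub>M lborel)"
    by (intro sets_pair_measure_cong) auto
  with assms show ?thesis using measurable_cong_sets by blast
qed

text \<open>The derivative is required only in the open interval, since some antiderivatives below
  are extended to an endpoint by a limit. Monotonicity ensures that \<open>ennreal\<close> does not
  truncate the difference.\<close>

lemma nn_integral_FTC_interior:
  fixes F f :: "real \<Rightarrow> real"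
  assumes "a \<le> b" and "continuous_on {a..b} F"
    and "\<And>x. a < x \<Longrightarrow> x < b \<Longrightarrow> (F has_real_derivative f x) (at x)"
    and "\<And>x. a < x \<Longrightarrow> x < b \<Longrightarrow> f x \<ge> 0"
  shows "(\<integral>\<^sup>+x. ennreal (f x) * indicator {a<..<b} x \<partial>lborel) = ennreal (F b - F a)"
    and "F a \<le> F b"
proof -
  have "(f has_integral (F b - F a)) {a..b}"
    using assms by (intro fundamental_theorem_of_calculus_interior)
      (auto simp flip: has_real_derivative_iff_has_vector_derivative)
  then have "(f has_integral (F b - F a)) {a<..<b}"
    by (simp add: has_integral_Icc_iff_Ioo)
  from nn_integral_has_integral_lebesgue'[OF _ this] has_integral_nonneg[OF this]
  show "(\<integral>\<^sup>+x. ennreal (f x) * indicator {a<..<b} x \<partial>lborel) = ennreal (F b - F a)"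
    and "F a \<le> F b"
    using assms(4) by auto
qed

lemma nn_integral_tail_fun:
  assumes k: "k \<ge> 1" and s: "s > 0"
  shows "(\<integral>\<^sup>+x. ennreal (x * I2 x * stir_deriv k x) * indicator {0<..<s} x \<partial>lborel)
    = ennreal (1 - tail_fun k s)"
    and "tail_fun k s \<le> 1"
proof -
  \<comment> \<open>\<open>- tail_fun k\<close>, extended to 0 by the limit from
    \<open>tail_fun_tendsto_1\<close>.\<close>
  define F where "F = (\<lambda>x. if x = 0 then -1 else - tail_fun k x)"
  have F: "(F has_real_derivative x * I2 x * stir_deriv k x) (at x)" if "x > 0" for x
  proof (rule has_field_derivative_transform_within_open[where S="{0<..}"])
    show "((\<lambda>x. - tail_fun k x) has_real_derivative x * I2 x * stir_deriv k x) (at x)"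
      using DERIV_minus[OF DERIV_tail_fun[OF that, of k]] by simp
  qed (use that in \<open>auto simp: F_def\<close>)
  have "continuous_on {0..s} F"
    unfolding continuous_on_def
  proof
    fix x assume x: "x \<in> {0..s}"
    show "(F \<longlongrightarrow> F x) (at x within {0..s})"
    proof (cases "x = 0")
      case True
      have "((\<lambda>x. - tail_fun k x) \<longlongrightarrow> -1) (at_right 0)"
        by (intro tendsto_intros tail_fun_tendsto_1 k)
      then have "(F \<longlongrightarrow> -1) (at_right 0)"
        by (rule Lim_transform_eventually)
          (auto simp: F_def eventually_at_right_field intro!: exI[of _ 1])
      then show ?thesis
        using True s by (simp add: at_within_Icc_at_right F_def)
    next
      case False
      then have "isCont F x" using x by (intro DERIV_isCont[OF F]) auto
      then show ?thesis
        using continuous_at_imp_continuous_at_within continuous_within by blast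
    qed
  qed
  moreover have "0 \<le> x * I2 x * stir_deriv k x" if "x > 0" for x
    using that I2_nonneg[OF that] by (simp add: stir_deriv_nonneg)
  ultimately have "(\<integral>\<^sup>+x. ennreal (x * I2 x * stir_deriv k x) * indicator {0<..<s} x \<partial>lborel)
    = ennreal (F s - F 0)" "F 0 \<le> F s"
    using s F nn_integral_FTC_interior[of 0 s F "\<lambda>x. x * I2 x * stir_deriv k x"] by simp_all
  then show "(\<integral>\<^sup>+x. ennreal (x * I2 x * stir_deriv k x) * indicator {0<..<s} x \<partial>lborel)
    = ennreal (1 - tail_fun k s)" and "tail_fun k s \<le> 1"
    using s by (simp_all add: F_def)
qed

section \<open>Transition kernel and joint density of the record chain\<close>

text \<open>Given \<open>S\<^sub>k = t\<close> and \<open>W\<^sub>k\<^sub>+\<^sub>1 = w\<close>, the density of \<open>(S\<^sub>k + E / w, w * U)\<close> at \<open>(t', w')\<close>; the Jacobian factors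
  \<open>w\<close> and \<open>1 / w\<close> cancel.\<close>
definition step_ker :: "real \<times> real \<Rightarrow> real \<times> real \<Rightarrow> real" where
  "step_ker z z' = (if fst z < fst z' \<and> 0 < snd z' \<and> snd z' < snd z
     then exp (- (snd z * (fst z' - fst z))) else 0)"

text \<open>Density of \<open>(S k, W (Suc k))\<close> for \<open>k \<ge> 1\<close>, by
  \<open>joint_law\<close>. For \<open>k = 0\<close> it is identically 0, whereas \<open>S 0\<close>
  is constant, so the induction starts at 1.\<close>

definition joint_dens :: "nat \<Rightarrow> real \<times> real \<Rightarrow> real" where
  "joint_dens k z = (if 0 < fst z \<and> 0 < snd z \<and> snd z < 1
     then (1 - snd z) * exp (- fst z) * stir_deriv k (fst z * (1 - snd z)) else 0)"

lemma borel_measurable_stir_deriv [measurable]: "stir_deriv k \<in> borel_measurable borel"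
  by (intro borel_measurable_continuous_onI continuous_at_imp_continuous_on ballI isCont_stir_deriv)

lemma joint_dens_measurable [measurable]: "joint_dens k \<in> borel_measurable (borel \<Otimes>\<^sub>M borel)"
  unfolding joint_dens_def by measurable

lemma joint_dens_measurable' [measurable]: "joint_dens k \<in> borel_measurable (lborel \<Otimes>\<^sub>M lborel)"
  by (rule borel_measurable_lborel_pair) (rule joint_dens_measurable)

lemma step_ker_measurable [measurable (raw)]:
  assumes [measurable]: "f \<in> M \<rightarrow>\<^sub>M borel \<Otimes>\<^sub>M borel" "g \<in> M \<rightarrow>\<^sub>M borel \<Otimes>\<^sub>M borel"
  shows "(\<lambda>x. step_ker (f x) (g x)) \<in> borel_measurable M"
  unfolding step_ker_def by measurable

lemma step_ker_measurable_snd: "step_ker z \<in> borel_measurable (borel \<Otimes>\<^sub>M borel)"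
  by (rule step_ker_measurable[where f="\<lambda>_. z" and g="\<lambda>z. z"]) (auto simp: space_pair_measure)

lemma step_ker_nonneg: "step_ker z z' \<ge> 0"
  by (simp add: step_ker_def)

text \<open>The chain starts at time 0 from the uniform value \<open>U 0\<close>, so averaging the
  kernel over \<open>w\<close> gives the density for \<open>k = 1\<close>.\<close>

lemma nn_integral_step_ker_0:
  "(\<integral>\<^sup>+w. ennreal (step_ker (0, w) z) * indicator {0..1} w \<partial>lborel) = ennreal (joint_dens 1 z)"
proof (cases z)
  case [simp]: (Pair t v)
  show ?thesis
  proof (cases "0 < t \<and> 0 < v \<and> v < 1")
    case True
    have "(\<integral>\<^sup>+w. ennreal (step_ker (0, w) z) * indicator {0..1} w \<partial>lborel)
      = (\<integral>\<^sup>+w. ennreal (exp (- (w * t))) * indicator {v<..<1} w \<partial>lborel)"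
      \<comment> \<open>The integrands can differ only at the null point
        \<open>w = 1\<close>.\<close>
      by (intro nn_integral_cong_AE, use AE_lborel_singleton[of 1] in eventually_elim)
        (use True in \<open>auto simp: step_ker_def split: split_indicator\<close>)
    also have "\<dots> = ennreal (- exp (- (1 * t)) / t - (- exp (- (v * t)) / t))"
      using True by (intro nn_integral_FTC_interior(1)[where F="\<lambda>w. - exp (- (w * t)) / t"])
        (auto intro!: derivative_eq_intros continuous_intros)
    also have "- exp (- (1 * t)) / t - (- exp (- (v * t)) / t) = joint_dens 1 z"
    proof -
      have "(t * (1 - v)) * stir_deriv 1 (t * (1 - v)) = exp (t * (1 - v)) - 1"
        by (rule mult_stir_deriv_1)
      then have "(1 - v) * stir_deriv 1 (t * (1 - v)) = (exp (t * (1 - v)) - 1) / t"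
        using True by (simp add: field_simps)
      moreover have "joint_dens 1 z = exp (- t) * ((1 - v) * stir_deriv 1 (t * (1 - v)))"
        using True by (simp add: joint_dens_def)
      ultimately have "joint_dens 1 z = exp (- t) * ((exp (t * (1 - v)) - 1) / t)"
        by simp
      also have "\<dots> = (exp (- (v * t)) - exp (- t)) / t"
        by (simp add: right_diff_distrib exp_add[symmetric] mult_ac)
      finally show ?thesis by (simp add: diff_divide_distrib)
    qed
    finally show ?thesis .
  next
    case False
    have "(\<integral>\<^sup>+w. ennreal (step_ker (0, w) z) * indicator {0..1} w \<partial>lborel) = (\<integral>\<^sup>+w. 0 \<partial>(lborel :: real measure))"
      by (intro nn_integral_cong) (use False in \<open>auto simp: step_ker_def split: split_indicator\<close>)
    then show ?thesis using False by (auto simp: joint_dens_def)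
  qed
qed

text \<open>In the product rule everything but \<open>stir_deriv k\<close> cancels. This
  antiderivative serves the integral over \<open>t\<close> in
  \<open>nn_integral_step_ker\<close>.\<close>

lemma DERIV_exp_add_stir:
  "((\<lambda>y. exp (- y) * (y * stir_deriv (Suc k) y + stir_series k y)) has_real_derivative
     exp (- y) * stir_deriv k y) (at y)"
proof -
  have "((\<lambda>y. exp (- y)) has_real_derivative - exp (- y)) (at y)"
    by (auto intro!: derivative_eq_intros)
  from DERIV_mult[OF this DERIV_add[OF DERIV_mult_stir_deriv DERIV_stir_series]] show ?thesis
    by (rule DERIV_cong) (simp add: algebra_simps)
qed

text \<open>Chapman-Kolmogorov equation. For fixed \<open>w\<close> the exponentials combine to
  \<open>exp (- w * t') * exp (- (t * (1 - w)))\<close>, so \<open>DERIV_exp_add_stir\<close>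
  integrates out \<open>t\<close>. The result contains the derivative of
  \<open>y * stir_deriv (Suc k) y\<close> at \<open>y = t' * (1 - w)\<close>, which is then
  integrated over \<open>w\<close>.\<close>

lemma nn_integral_step_ker:
  assumes k: "k \<ge> 1"
  shows "(\<integral>\<^sup>+z. ennreal (step_ker z z') * ennreal (joint_dens k z) \<partial>(lborel \<Otimes>\<^sub>M lborel))
    = ennreal (joint_dens (Suc k) z')"
proof (cases z')
  case [simp]: (Pair t' w')
  have "(\<integral>\<^sup>+z. ennreal (step_ker z z') * ennreal (joint_dens k z) \<partial>(lborel \<Otimes>\<^sub>M lborel))
    = (\<integral>\<^sup>+w. \<integral>\<^sup>+t. ennreal (step_ker (t, w) z') * ennreal (joint_dens k (t, w)) \<partial>lborel \<partial>lborel)"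
    by (subst lborel_pair.nn_integral_snd[symmetric]) auto
  also have "\<dots> = ennreal (joint_dens (Suc k) z')"
  proof (cases "0 < t' \<and> 0 < w' \<and> w' < 1")
    case True
    let ?G = "\<lambda>y. y * stir_deriv (Suc k) y + stir_series k y"
    have inner: "(\<integral>\<^sup>+t. ennreal (step_ker (t, w) z') * ennreal (joint_dens k (t, w)) \<partial>lborel)
      = ennreal (exp (- t') * ?G (t' * (1 - w))) * indicator {w'<..<1} w" for w
    proof (cases "w' < w \<and> w < 1")
      case w: True
      have "(\<integral>\<^sup>+t. ennreal (step_ker (t, w) z') * ennreal (joint_dens k (t, w)) \<partial>lborel)
        = (\<integral>\<^sup>+t. ennreal (exp (- w * t') * ((1 - w) * (exp (- (t * (1 - w))) * stir_deriv k (t * (1 - w)))))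
            * indicator {0<..<t'} t \<partial>lborel)"
      proof (intro nn_integral_cong)
        fix t
        have "exp (- (w * (t' - t))) * exp (- t) = exp (- w * t') * exp (- (t * (1 - w)))"
          by (simp add: exp_add[symmetric] algebra_simps)
        then have eq: "exp (- (w * (t' - t))) * ((1 - w) * exp (- t) * stir_deriv k (t * (1 - w)))
          = exp (- w * t') * ((1 - w) * (exp (- (t * (1 - w))) * stir_deriv k (t * (1 - w))))"
          by (metis (no_types, lifting) mult.assoc mult.left_commute)
        show "ennreal (step_ker (t, w) z') * ennreal (joint_dens k (t, w))
          = ennreal (exp (- w * t') * ((1 - w) * (exp (- (t * (1 - w))) * stir_deriv k (t * (1 - w)))))
            * indicator {0<..<t'} t"
        proof (cases "0 < t \<and> t < t'")
          case t: True
          have "ennreal (step_ker (t, w) z') * ennreal (joint_dens k (t, w))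
            = ennreal (step_ker (t, w) z' * joint_dens k (t, w))"
            by (rule ennreal_mult'[symmetric]) (rule step_ker_nonneg)
          also have "step_ker (t, w) z' * joint_dens k (t, w)
            = exp (- (w * (t' - t))) * ((1 - w) * exp (- t) * stir_deriv k (t * (1 - w)))"
            using True w t by (simp add: step_ker_def joint_dens_def)
          finally show ?thesis unfolding eq using t by simp
        qed (auto simp: step_ker_def joint_dens_def)
      qed
      also have "\<dots> = ennreal (exp (- w * t') * (exp (- (t' * (1 - w))) * ?G (t' * (1 - w)))
           - exp (- w * t') * (exp (- (0 * (1 - w))) * ?G (0 * (1 - w))))"
      proof (intro nn_integral_FTC_interior(1)[where
            F="\<lambda>t. exp (- w * t') * (exp (- (t * (1 - w))) * ?G (t * (1 - w)))"])
        have D: "((\<lambda>t. exp (- w * t') * (exp (- (t * (1 - w))) * ?G (t * (1 - w)))) has_real_derivative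
          exp (- w * t') * ((1 - w) * (exp (- (t * (1 - w))) * stir_deriv k (t * (1 - w))))) (at t)" for t
        proof -
          have "((\<lambda>t. t * (1 - w)) has_real_derivative 1 - w) (at t)"
            by (auto intro!: derivative_eq_intros)
          from DERIV_cmult[OF DERIV_chain2[OF DERIV_exp_add_stir this], of "exp (- w * t')"]
          show ?thesis by (rule DERIV_cong) (simp add: mult_ac)
        qed
        then show "continuous_on {0..t'} (\<lambda>t. exp (- w * t') * (exp (- (t * (1 - w))) * ?G (t * (1 - w))))"
          by (meson DERIV_isCont continuous_at_imp_continuous_on)
        show "((\<lambda>t. exp (- w * t') * (exp (- (t * (1 - w))) * ?G (t * (1 - w)))) has_real_derivative
          exp (- w * t') * ((1 - w) * (exp (- (t * (1 - w))) * stir_deriv k (t * (1 - w))))) (at t)" for t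
          by (rule D)
      qed (use True w in \<open>auto intro!: mult_nonneg_nonneg stir_deriv_nonneg\<close>)
      \<comment> \<open>The lower limit contributes \<open>stir_series k 0\<close>, which is 0
        because \<open>k \<ge> 1\<close>.\<close>
      also have "exp (- w * t') * (exp (- (t' * (1 - w))) * ?G (t' * (1 - w)))
           - exp (- w * t') * (exp (- (0 * (1 - w))) * ?G (0 * (1 - w))) = exp (- t') * ?G (t' * (1 - w))"
      proof -
        have "exp (- w * t') * exp (- (t' * (1 - w))) = exp (- t')"
          by (simp add: exp_add[symmetric] algebra_simps)
        then show ?thesis using k by (simp add: stir_series_0 mult.assoc[symmetric])
      qed
      finally show ?thesis using w by simp
    next
      case w: False
      have "(\<integral>\<^sup>+t. ennreal (step_ker (t, w) z') * ennreal (joint_dens k (t, w)) \<partial>lborel) = (\<integral>\<^sup>+t. 0 \<partial>(lborel::real measure))"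
        by (intro nn_integral_cong) (use w in \<open>auto simp: step_ker_def joint_dens_def\<close>)
      then show ?thesis using w by auto
    qed
    have "(\<integral>\<^sup>+w. ennreal (exp (- t') * ?G (t' * (1 - w))) * indicator {w'<..<1} w \<partial>lborel)
      = ennreal (- (exp (- t') / t') * (t' * (1 - 1) * stir_deriv (Suc k) (t' * (1 - 1)))
         - - (exp (- t') / t') * (t' * (1 - w') * stir_deriv (Suc k) (t' * (1 - w'))))"
    \<comment> \<open>Division by \<open>t'\<close> compensates the chain rule for
      \<open>t' * (1 - w)\<close>; at \<open>w = 1\<close> the antiderivative vanishes.\<close>
    proof (intro nn_integral_FTC_interior(1)[where
          F="\<lambda>w. - (exp (- t') / t') * (t' * (1 - w) * stir_deriv (Suc k) (t' * (1 - w)))"])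
      have D: "((\<lambda>w. - (exp (- t') / t') * (t' * (1 - w) * stir_deriv (Suc k) (t' * (1 - w)))) has_real_derivative
          exp (- t') * ?G (t' * (1 - w))) (at w)" for w
      proof -
        have "((\<lambda>w. t' * (1 - w)) has_real_derivative - t') (at w)"
          by (auto intro!: derivative_eq_intros)
        from DERIV_cmult[OF DERIV_chain2[OF DERIV_mult_stir_deriv this], of "- (exp (- t') / t')"]
        show ?thesis by (rule DERIV_cong) (use True in \<open>simp add: field_simps\<close>)
      qed
      then show "continuous_on {w'..1} (\<lambda>w. - (exp (- t') / t') * (t' * (1 - w) * stir_deriv (Suc k) (t' * (1 - w))))"
        by (meson DERIV_isCont continuous_at_imp_continuous_on)
      show "((\<lambda>w. - (exp (- t') / t') * (t' * (1 - w) * stir_deriv (Suc k) (t' * (1 - w)))) has_real_derivative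
          exp (- t') * ?G (t' * (1 - w))) (at w)" for w by (rule D)
    qed (use True in \<open>auto intro!: mult_nonneg_nonneg add_nonneg_nonneg stir_deriv_nonneg stir_series_nonneg\<close>)
    also have "\<dots> = ennreal (joint_dens (Suc k) z')"
      using True by (simp add: joint_dens_def mult_ac)
    finally show ?thesis unfolding inner .
  next
    case False
    have "(\<integral>\<^sup>+t. ennreal (step_ker (t, w) z') * ennreal (joint_dens k (t, w)) \<partial>lborel) = 0" for w
    proof -
      have "(\<integral>\<^sup>+t. ennreal (step_ker (t, w) z') * ennreal (joint_dens k (t, w)) \<partial>lborel) = (\<integral>\<^sup>+t. 0 \<partial>(lborel::real measure))"
        by (intro nn_integral_cong) (use False in \<open>auto simp: step_ker_def joint_dens_def\<close>)
      then show ?thesis by simp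
    qed
    then show ?thesis using False by (auto simp: joint_dens_def)
  qed
  finally show ?thesis .
qed

section \<open>Integrating out the record value\<close>

text \<open>This is the substitution \<open>x / v\<close> in \<open>I2\<close>: the derivative of
  \<open>x * I2 (x / v)\<close> in \<open>v\<close> is \<open>exp (- (x / v))\<close>.\<close>

lemma nn_integral_exp_neg_div:
  assumes x: "x > 0"
  shows "(\<integral>\<^sup>+v. ennreal (exp (- (x / v))) * indicator {0<..<1} v \<partial>lborel) = ennreal (x * I2 x)"
proof -
  \<comment> \<open>The value at \<open>v = 0\<close> is the limit, since
    \<open>I2_le_inverse\<close> bounds \<open>x * I2 (x / v)\<close> by \<open>v\<close>.\<close>
  define F where "F = (\<lambda>v. if v = 0 then 0 else x * I2 (x / v))"
  have D: "(F has_real_derivative exp (- (x / v))) (at v)" if v: "v > 0" for v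
  proof (rule has_field_derivative_transform_within_open[where S="{0<..}"])
    have "((\<lambda>v. x / v) has_real_derivative - x / v\<^sup>2) (at v)"
      using v by (auto intro!: derivative_eq_intros simp: power2_eq_square)
    from DERIV_cmult[OF DERIV_chain2[OF DERIV_I2 this], of x]
    show "((\<lambda>v. x * I2 (x / v)) has_real_derivative exp (- (x / v))) (at v)"
      using x v by (auto elim!: DERIV_cong simp: power2_eq_square field_simps)
  qed (use v in \<open>auto simp: F_def\<close>)
  have lim: "(F \<longlongrightarrow> 0) (at_right 0)"
  proof (rule Lim_null_comparison)
    have "norm (F v) \<le> v" if "v > 0" for v
    proof -
      have "x * I2 (x / v) \<le> x * (1 / (x / v))"
        using x that by (intro mult_left_mono I2_le_inverse) auto
      then show ?thesis
        using x that I2_nonneg[of "x / v"] by (simp add: F_def)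
    qed
    then show "\<forall>\<^sub>F v in at_right 0. norm (F v) \<le> v"
      by (auto simp: eventually_at_right_field intro!: exI[of _ 1])
  qed (rule tendsto_ident_at)
  have "continuous_on {0..1} F"
    unfolding continuous_on_def
  proof
    fix v :: real assume v: "v \<in> {0..1}"
    show "(F \<longlongrightarrow> F v) (at v within {0..1})"
    proof (cases "v = 0")
      case True
      then show ?thesis using lim by (simp add: at_within_Icc_at_right F_def)
    next
      case False
      then have "isCont F v" using v by (intro DERIV_isCont[OF D]) auto
      then show ?thesis
        using continuous_at_imp_continuous_at_within continuous_within by blast
    qed
  qed
  then have "(\<integral>\<^sup>+v. ennreal (exp (- (x / v))) * indicator {0<..<1} v \<partial>lborel) = ennreal (F 1 - F 0)"
    using D nn_integral_FTC_interior(1)[of 0 1 F "\<lambda>v. exp (- (x / v))"] by simp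
  then show ?thesis by (simp add: F_def)
qed

text \<open>With \<open>v = 1 - w\<close> and \<open>x = t * v\<close> the region becomes
  \<open>x \<le> s\<close>. After Fubini the integral over \<open>v\<close> gives
  \<open>x * I2 x\<close>, and \<open>nn_integral_tail_fun\<close> evaluates the integral over
  \<open>x\<close>.\<close>

lemma nn_integral_joint_dens_region:
  assumes k: "k \<ge> 1" and s: "s > 0"
  shows "(\<integral>\<^sup>+z. indicator {z. fst z * (1 - snd z) \<le> s} z * ennreal (joint_dens k z) \<partial>(lborel \<Otimes>\<^sub>M lborel))
    = ennreal (1 - tail_fun k s)"
proof -
  have "(\<integral>\<^sup>+z. indicator {z. fst z * (1 - snd z) \<le> s} z * ennreal (joint_dens k z) \<partial>(lborel \<Otimes>\<^sub>M lborel))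
    = (\<integral>\<^sup>+w. \<integral>\<^sup>+t. indicator {z. fst z * (1 - snd z) \<le> s} (t, w) * ennreal (joint_dens k (t, w)) \<partial>lborel \<partial>lborel)"
    by (subst lborel_pair.nn_integral_snd[symmetric]) auto
  also have "\<dots> = (\<integral>\<^sup>+v. \<integral>\<^sup>+t. indicator {z. fst z * (1 - snd z) \<le> s} (t, 1 - v) * ennreal (joint_dens k (t, 1 - v)) \<partial>lborel \<partial>lborel)"
    by (subst nn_integral_real_affine[where c="-1" and t=1]) auto
  also have "\<dots> = (\<integral>\<^sup>+v. \<integral>\<^sup>+x. ennreal (exp (- (x / v)) * stir_deriv k x) * indicator {0<..s} x * indicator {0<..<1} v \<partial>lborel \<partial>lborel)"
  proof (rule nn_integral_cong)
    fix v :: real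
    show "(\<integral>\<^sup>+t. indicator {z. fst z * (1 - snd z) \<le> s} (t, 1 - v) * ennreal (joint_dens k (t, 1 - v)) \<partial>lborel)
      = (\<integral>\<^sup>+x. ennreal (exp (- (x / v)) * stir_deriv k x) * indicator {0<..s} x * indicator {0<..<1} v \<partial>lborel)"
    proof (cases "0 < v \<and> v < 1")
      case v: True
      \<comment> \<open>The factor \<open>1 / v\<close> from the scaling cancels the factor
        \<open>1 - w = v\<close> of \<open>joint_dens\<close>.\<close>
      have "(\<integral>\<^sup>+t. indicator {z. fst z * (1 - snd z) \<le> s} (t, 1 - v) * ennreal (joint_dens k (t, 1 - v)) \<partial>lborel)
        = ennreal (1 / v) * (\<integral>\<^sup>+x. indicator {z. fst z * (1 - snd z) \<le> s} (x / v, 1 - v) * ennreal (joint_dens k (x / v, 1 - v)) \<partial>lborel)"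
        using v by (subst nn_integral_real_affine[where c="1 / v" and t=0]) auto
      also have "\<dots> = (\<integral>\<^sup>+x. ennreal (1 / v) * (indicator {z. fst z * (1 - snd z) \<le> s} (x / v, 1 - v) * ennreal (joint_dens k (x / v, 1 - v))) \<partial>lborel)"
        by (rule nn_integral_cmult[symmetric]) auto
      also have "\<dots> = (\<integral>\<^sup>+x. ennreal (exp (- (x / v)) * stir_deriv k x) * indicator {0<..s} x * indicator {0<..<1} v \<partial>lborel)"
        using v by (intro nn_integral_cong)
          (auto simp: joint_dens_def zero_less_divide_iff ennreal_mult'[symmetric] split: split_indicator)
      finally show ?thesis .
    next
      case False
      have "(\<integral>\<^sup>+t. indicator {z. fst z * (1 - snd z) \<le> s} (t, 1 - v) * ennreal (joint_dens k (t, 1 - v)) \<partial>lborel) = (\<integral>\<^sup>+t. 0 \<partial>(lborel::real measure))"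
        by (intro nn_integral_cong) (use False in \<open>auto simp: joint_dens_def\<close>)
      then show ?thesis using False by simp
    qed
  qed
  also have "\<dots> = (\<integral>\<^sup>+x. \<integral>\<^sup>+v. ennreal (exp (- (x / v)) * stir_deriv k x) * indicator {0<..s} x * indicator {0<..<1} v \<partial>lborel \<partial>lborel)"
    by (rule lborel_pair.Fubini') auto
  also have "\<dots> = (\<integral>\<^sup>+x. ennreal (x * I2 x * stir_deriv k x) * indicator {0<..s} x \<partial>lborel)"
  proof (rule nn_integral_cong)
    fix x :: real
    show "(\<integral>\<^sup>+v. ennreal (exp (- (x / v)) * stir_deriv k x) * indicator {0<..s} x * indicator {0<..<1} v \<partial>lborel)
      = ennreal (x * I2 x * stir_deriv k x) * indicator {0<..s} x"
    proof (cases "0 < x \<and> x \<le> s")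
      case True
      have "(\<integral>\<^sup>+v. ennreal (exp (- (x / v)) * stir_deriv k x) * indicator {0<..s} x * indicator {0<..<1} v \<partial>lborel)
        = (\<integral>\<^sup>+v. ennreal (stir_deriv k x) * (ennreal (exp (- (x / v))) * indicator {0<..<1} v) \<partial>lborel)"
        using True by (intro nn_integral_cong) (simp add: ennreal_mult stir_deriv_nonneg mult_ac)
      also have "\<dots> = ennreal (stir_deriv k x) * ennreal (x * I2 x)"
        using True by (subst nn_integral_cmult) (auto simp: nn_integral_exp_neg_div)
      also have "\<dots> = ennreal (x * I2 x * stir_deriv k x)"
        using True I2_nonneg[of x]
        by (simp add: ennreal_mult'[symmetric] stir_deriv_nonneg mult_ac)
      finally show ?thesis using True by simp
    qed auto
  qed
  also have "\<dots> = (\<integral>\<^sup>+x. ennreal (x * I2 x * stir_deriv k x) * indicator {0<..<s} x \<partial>lborel)"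
    by (intro nn_integral_cong_AE, use AE_lborel_singleton[of s] in eventually_elim)
      (auto split: split_indicator)
  also have "\<dots> = ennreal (1 - tail_fun k s)"
    by (rule nn_integral_tail_fun[OF k s])
  finally show ?thesis .
qed

section \<open>One step of the chain\<close>

text \<open>The substitutions \<open>w' = w * u\<close> and \<open>t' = t + e / w\<close>, carried
  out from the kernel side.\<close>

lemma nn_integral_exp_uniform_step:
  assumes w: "w > 0" and [measurable]: "\<phi> \<in> borel_measurable (borel \<Otimes>\<^sub>M borel)"
  shows "(\<integral>\<^sup>+x. ennreal (exponential_density 1 (fst x)) * ennreal (indicator {0..1} (snd x))
            * \<phi> (t + fst x / w, w * snd x) \<partial>(lborel \<Otimes>\<^sub>M lborel))
    = (\<integral>\<^sup>+z'. ennreal (step_ker (t, w) z') * \<phi> z' \<partial>(lborel \<Otimes>\<^sub>M lborel))"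
proof -
  note [measurable] = borel_measurable_lborel_pair[OF assms(2)]
  have "(\<integral>\<^sup>+z'. ennreal (step_ker (t, w) z') * \<phi> z' \<partial>(lborel \<Otimes>\<^sub>M lborel))
    = (\<integral>\<^sup>+t'. \<integral>\<^sup>+w'. ennreal (step_ker (t, w) (t', w')) * \<phi> (t', w') \<partial>lborel \<partial>lborel)"
    by (subst lborel.nn_integral_fst[symmetric]) auto
  also have "\<dots> = (\<integral>\<^sup>+t'. ennreal w * (\<integral>\<^sup>+u. ennreal (step_ker (t, w) (t', w * u)) * \<phi> (t', w * u) \<partial>lborel) \<partial>lborel)"
  proof (rule nn_integral_cong)
    fix t'
    show "(\<integral>\<^sup>+w'. ennreal (step_ker (t, w) (t', w')) * \<phi> (t', w') \<partial>lborel)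
      = ennreal w * (\<integral>\<^sup>+u. ennreal (step_ker (t, w) (t', w * u)) * \<phi> (t', w * u) \<partial>lborel)"
      using w by (subst nn_integral_real_affine[where c=w and t=0]) auto
  qed
  also have "\<dots> = ennreal (1 / w) * (\<integral>\<^sup>+e. ennreal w * (\<integral>\<^sup>+u. ennreal (step_ker (t, w) (t + e / w, w * u))
      * \<phi> (t + e / w, w * u) \<partial>lborel) \<partial>lborel)"
    using w by (subst nn_integral_real_affine[where c="1 / w" and t=t]) auto
  also have "\<dots> = (\<integral>\<^sup>+e. ennreal (1 / w) * (ennreal w * (\<integral>\<^sup>+u. ennreal (step_ker (t, w) (t + e / w, w * u))
      * \<phi> (t + e / w, w * u) \<partial>lborel)) \<partial>lborel)"
    by (rule nn_integral_cmult[symmetric]) auto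
  also have "\<dots> = (\<integral>\<^sup>+e. \<integral>\<^sup>+u. ennreal (step_ker (t, w) (t + e / w, w * u)) * \<phi> (t + e / w, w * u) \<partial>lborel \<partial>lborel)"
    using w by (simp add: mult.assoc[symmetric] ennreal_mult'[symmetric])
  also have "\<dots> = (\<integral>\<^sup>+e. \<integral>\<^sup>+u. ennreal (exponential_density 1 e) * ennreal (indicator {0..1} u)
      * \<phi> (t + e / w, w * u) \<partial>lborel \<partial>lborel)"
  \<comment> \<open>The kernel uses strict inequalities, the densities closed ranges; they can
    disagree only for \<open>e = 0\<close>, \<open>u = 0\<close> or \<open>u = 1\<close>, which are
    null.\<close>
  proof (rule nn_integral_cong_AE, use AE_lborel_singleton[of 0] in eventually_elim)
    case (elim e)
    show ?case
    proof (rule nn_integral_cong_AE, use AE_lborel_singleton[of 0] AE_lborel_singleton[of 1] in eventually_elim)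
      case (elim u)
      then show ?case
        using \<open>e \<noteq> 0\<close> w
        by (auto simp: step_ker_def exponential_density_def zero_less_divide_iff zero_less_mult_iff
            split: split_indicator)
    qed
  qed
  also have "\<dots> = (\<integral>\<^sup>+x. ennreal (exponential_density 1 (fst x)) * ennreal (indicator {0..1} (snd x))
            * \<phi> (t + fst x / w, w * snd x) \<partial>(lborel \<Otimes>\<^sub>M lborel))"
    by (subst lborel.nn_integral_fst[symmetric]) auto
  finally show ?thesis ..
qed

text \<open>Independence makes the joint law a product, so \<open>(E, U)\<close> can be integrated
  out for fixed \<open>(S, W)\<close>. The pair \<open>(S, W)\<close> enters through its
  distribution rather than a density, so that the step also applies to the constant
  \<open>S 0 = 0\<close>.\<close>

lemma (in prob_space) nn_integral_indep_step:
  assumes ind: "indep_var (borel \<Otimes>\<^sub>M borel) (\<lambda>\<omega>. (S \<omega>, W \<omega>)) (lborel \<Otimes>\<^sub>M lborel) (\<lambda>\<omega>. (E \<omega>, U \<omega>))"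
    and EU: "indep_var lborel E lborel U"
    and E: "distributed M lborel E (\<lambda>x. ennreal (exponential_density 1 x))"
    and U: "distributed M lborel U (\<lambda>x. ennreal (indicator {0..1} x))"
    and W: "AE \<omega> in M. W \<omega> > 0"
    and \<phi> [measurable]: "\<phi> \<in> borel_measurable (borel \<Otimes>\<^sub>M borel)"
  shows "(\<integral>\<^sup>+\<omega>. \<phi> (S \<omega> + E \<omega> / W \<omega>, W \<omega> * U \<omega>) \<partial>M)
    = (\<integral>\<^sup>+\<omega>. \<integral>\<^sup>+z'. ennreal (step_ker (S \<omega>, W \<omega>) z') * \<phi> z' \<partial>(lborel \<Otimes>\<^sub>M lborel) \<partial>M)"
proof -
  let ?X = "\<lambda>\<omega>. (S \<omega>, W \<omega>)" and ?Y = "\<lambda>\<omega>. (E \<omega>, U \<omega>)"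
  let ?DX = "distr M (borel \<Otimes>\<^sub>M borel) ?X" and ?DY = "distr M (lborel \<Otimes>\<^sub>M lborel) ?Y"
  let ?\<psi> = "\<lambda>(x, y). \<phi> (fst x + fst y / snd x, snd x * snd y)"
  have X[measurable]: "?X \<in> M \<rightarrow>\<^sub>M borel \<Otimes>\<^sub>M borel" and Y[measurable]: "?Y \<in> M \<rightarrow>\<^sub>M lborel \<Otimes>\<^sub>M lborel"
    and eq: "?DX \<Otimes>\<^sub>M ?DY = distr M ((borel \<Otimes>\<^sub>M borel) \<Otimes>\<^sub>M (lborel \<Otimes>\<^sub>M lborel)) (\<lambda>x. (?X x, ?Y x))"
    using ind unfolding indep_var_distribution_eq by auto
  interpret Y: prob_space ?DY by (rule prob_space_distr) (rule Y)
  have Y': "distributed M (lborel \<Otimes>\<^sub>M lborel) ?Y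
      (\<lambda>(x, y). ennreal (exponential_density 1 x) * ennreal (indicator {0..1} y))"
    by (rule distributed_joint_indep[OF _ _ E U EU]) (unfold_locales)
  have "(\<integral>\<^sup>+\<omega>. \<phi> (S \<omega> + E \<omega> / W \<omega>, W \<omega> * U \<omega>) \<partial>M)
    = (\<integral>\<^sup>+x. ?\<psi> x \<partial>distr M ((borel \<Otimes>\<^sub>M borel) \<Otimes>\<^sub>M (lborel \<Otimes>\<^sub>M lborel)) (\<lambda>x. (?X x, ?Y x)))"
    by (subst nn_integral_distr) (auto simp: comp_def)
  also have "\<dots> = (\<integral>\<^sup>+x. \<integral>\<^sup>+y. ?\<psi> (x, y) \<partial>?DY \<partial>?DX)"
    unfolding eq[symmetric] by (rule Y.nn_integral_fst[symmetric]) measurable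
  also have "\<dots> = (\<integral>\<^sup>+\<omega>. \<integral>\<^sup>+y. ?\<psi> (?X \<omega>, y) \<partial>?DY \<partial>M)"
    by (subst nn_integral_distr) (auto intro!: Y.borel_measurable_nn_integral)
  also have "\<dots> = (\<integral>\<^sup>+\<omega>. \<integral>\<^sup>+z'. ennreal (step_ker (S \<omega>, W \<omega>) z') * \<phi> z' \<partial>(lborel \<Otimes>\<^sub>M lborel) \<partial>M)"
  proof (rule nn_integral_cong_AE, use W in eventually_elim)
    case (elim \<omega>)
    have "(\<integral>\<^sup>+y. ?\<psi> (?X \<omega>, y) \<partial>?DY) = (\<integral>\<^sup>+\<omega>'. ?\<psi> (?X \<omega>, ?Y \<omega>') \<partial>M)"
      by (subst nn_integral_distr) auto
    also have "\<dots> = (\<integral>\<^sup>+y. (case y of (x, y) \<Rightarrow> ennreal (exponential_density 1 x) * ennreal (indicator {0..1} y))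
        * ?\<psi> (?X \<omega>, y) \<partial>(lborel \<Otimes>\<^sub>M lborel))"
      by (rule distributed_nn_integral[OF Y', symmetric]) auto
    also have "\<dots> = (\<integral>\<^sup>+z'. ennreal (step_ker (S \<omega>, W \<omega>) z') * \<phi> z' \<partial>(lborel \<Otimes>\<^sub>M lborel))"
      using nn_integral_exp_uniform_step[OF elim \<phi>, of "S \<omega>"] by (simp add: case_prod_beta)
    finally show ?case .
  qed
  finally show ?thesis .
qed

section \<open>The law of the record process\<close>

locale record_process = prob_space M for M :: "'a measure" +
  fixes U E :: "nat \<Rightarrow> 'a \<Rightarrow> real"
  assumes U: "\<And>j. distributed M lborel (U j) (\<lambda>x. ennreal (indicator {0..1} x))"
    and E: "\<And>j. j \<ge> 1 \<Longrightarrow> distributed M lborel (E j) (\<lambda>x. ennreal (exponential_density 1 x))"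
    and indep: "indep_vars (\<lambda>_. borel)
           (\<lambda>i. case i of Inl j \<Rightarrow> U j | Inr j \<Rightarrow> E j) (range Inl \<union> Inr ` {1..})"
begin

definition W :: "nat \<Rightarrow> 'a \<Rightarrow> real" where
  "W k \<omega> = (\<Prod>m=0..<k. U m \<omega>)"

definition S :: "nat \<Rightarrow> 'a \<Rightarrow> real" where
  "S k \<omega> = (\<Sum>i=1..k. E i \<omega> / W i \<omega>)"

lemma S_Suc: "S (Suc k) \<omega> = S k \<omega> + E (Suc k) \<omega> / W (Suc k) \<omega>"
  by (simp add: S_def)

lemma W_Suc: "W (Suc k) \<omega> = W k \<omega> * U k \<omega>"
  by (simp add: W_def)

text \<open>The product in the second factor of \<open>B_var\<close> has \<open>k + 1\<close>
  uniform factors, hence \<open>W (Suc k)\<close>.\<close>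

lemma B_var_eq: "B_var U E k \<omega> = S k \<omega> * (1 - W (Suc k) \<omega>)"
  by (simp add: B_var_def S_def W_def atLeastLessThanSuc_atLeastAtMost)

lemma U_measurable [measurable]: "U j \<in> borel_measurable M"
  using distributed_measurable[OF U, of j] by simp

lemma E_measurable: "j \<ge> 1 \<Longrightarrow> E j \<in> borel_measurable M"
  using distributed_measurable[OF E, of j] by simp

lemma W_measurable [measurable]: "W k \<in> borel_measurable M"
  unfolding W_def by measurable

lemma S_measurable [measurable]: "S k \<in> borel_measurable M"
  unfolding S_def by (intro borel_measurable_sum borel_measurable_divide E_measurable W_measurable) auto

lemma AE_W_pos: "AE \<omega> in M. W k \<omega> > 0"
proof -
  have "AE \<omega> in M. U j \<omega> > 0" for j
  proof (rule AE_distrD[where M'=lborel])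
    show "U j \<in> M \<rightarrow>\<^sub>M lborel" by simp
    show "AE x in distr M lborel (U j). 0 < x"
      unfolding distributed_distr_eq_density[OF U]
      by (subst AE_density, simp, use AE_lborel_singleton[of 0] in eventually_elim)
        (auto split: split_indicator_asm)
  qed
  then have "AE \<omega> in M. \<forall>j. U j \<omega> > 0" by (simp add: AE_all_countable)
  then show ?thesis by eventually_elim (simp add: W_def prod_pos)
qed

text \<open>\<open>(S k, W (Suc k))\<close> depends only on \<open>U 0\<close>, ...,
  \<open>U k\<close> and \<open>E 1\<close>, ..., \<open>E k\<close>; the next pair has indices
  outside this set.\<close>

lemma indep_SW_EU:
  "indep_var (borel \<Otimes>\<^sub>M borel) (\<lambda>\<omega>. (S k \<omega>, W (Suc k) \<omega>))
     (lborel \<Otimes>\<^sub>M lborel) (\<lambda>\<omega>. (E (Suc k) \<omega>, U (Suc k) \<omega>))"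
proof -
  let ?X = "\<lambda>i. case i of Inl j \<Rightarrow> U j | Inr j \<Rightarrow> E j"
  let ?A = "Inl ` {0..k} \<union> Inr ` {1..k} :: (nat + nat) set"
  let ?B = "{Inl (Suc k), Inr (Suc k)} :: (nat + nat) set"
  let ?f = "\<lambda>x. (\<Sum>i=1..k. x (Inr i) / (\<Prod>m=0..<i. x (Inl m)) :: real, \<Prod>m=0..<Suc k. x (Inl m))"
  let ?g = "\<lambda>x :: nat + nat \<Rightarrow> real. (x (Inr (Suc k)), x (Inl (Suc k)))"
  have "indep_var (borel \<Otimes>\<^sub>M borel) (?f \<circ> (\<lambda>\<omega>. \<lambda>i\<in>?A. ?X i \<omega>))
    (lborel \<Otimes>\<^sub>M lborel) (?g \<circ> (\<lambda>\<omega>. \<lambda>i\<in>?B. ?X i \<omega>))"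
  proof (rule indep_var_compose[OF indep_var_restrict[OF indep]])
    show "?f \<in> PiM ?A (\<lambda>_. borel) \<rightarrow>\<^sub>M borel \<Otimes>\<^sub>M borel"
      by (intro measurable_Pair borel_measurable_sum borel_measurable_divide borel_measurable_prod
          measurable_component_singleton) auto
    show "?g \<in> PiM ?B (\<lambda>_. borel) \<rightarrow>\<^sub>M lborel \<Otimes>\<^sub>M lborel"
      by (intro measurable_Pair) (simp_all add: measurable_component_singleton)
  qed auto
  also have "?f \<circ> (\<lambda>\<omega>. \<lambda>i\<in>?A. ?X i \<omega>) = (\<lambda>\<omega>. (S k \<omega>, W (Suc k) \<omega>))"
    by (auto simp: fun_eq_iff S_def W_def intro!: sum.cong prod.cong arg_cong2[where f="(/)"])
  also have "?g \<circ> (\<lambda>\<omega>. \<lambda>i\<in>?B. ?X i \<omega>) = (\<lambda>\<omega>. (E (Suc k) \<omega>, U (Suc k) \<omega>))"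
    by (auto simp: fun_eq_iff)
  finally show ?thesis .
qed

lemma indep_E_U: "indep_var lborel (E (Suc k)) lborel (U (Suc k))"
proof -
  let ?X = "\<lambda>i. case i of Inl j \<Rightarrow> U j | Inr j \<Rightarrow> E j"
  let ?A = "{Inr (Suc k)} :: (nat + nat) set" and ?B = "{Inl (Suc k)} :: (nat + nat) set"
  have "indep_var lborel ((\<lambda>x. x (Inr (Suc k))) \<circ> (\<lambda>\<omega>. \<lambda>i\<in>?A. ?X i \<omega>))
    lborel ((\<lambda>x. x (Inl (Suc k))) \<circ> (\<lambda>\<omega>. \<lambda>i\<in>?B. ?X i \<omega>))"
    by (rule indep_var_compose[OF indep_var_restrict[OF indep]])
      (auto simp: measurable_component_singleton)
  then show ?thesis by (simp add: comp_def)
qed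

lemma nn_integral_Suc:
  assumes "\<phi> \<in> borel_measurable (borel \<Otimes>\<^sub>M borel)"
  shows "(\<integral>\<^sup>+\<omega>. \<phi> (S (Suc k) \<omega>, W (Suc (Suc k)) \<omega>) \<partial>M)
    = (\<integral>\<^sup>+\<omega>. \<integral>\<^sup>+z'. ennreal (step_ker (S k \<omega>, W (Suc k) \<omega>) z') * \<phi> z' \<partial>(lborel \<Otimes>\<^sub>M lborel) \<partial>M)"
  \<comment> \<open>\<open>W\<close> is unfolded at one index only: \<open>W (Suc k)\<close> has to
    stay intact as the state from which the step starts.\<close>
  unfolding S_Suc W_Suc[of "Suc k"]
  using indep_SW_EU indep_E_U E U AE_W_pos assms by (rule nn_integral_indep_step) simp

text \<open>Stated for all test functions \<open>\<phi>\<close>, so that the induction hypothesis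
  applies to the integral of \<open>\<phi>\<close> against \<open>step_ker z\<close>, as a function
  of \<open>z\<close>. Fubini and \<open>nn_integral_step_ker\<close> then finish the step.\<close>

lemma joint_law:
  assumes "k \<ge> 1" "\<phi> \<in> borel_measurable (borel \<Otimes>\<^sub>M borel)"
  shows "(\<integral>\<^sup>+\<omega>. \<phi> (S k \<omega>, W (Suc k) \<omega>) \<partial>M)
    = (\<integral>\<^sup>+z. \<phi> z * ennreal (joint_dens k z) \<partial>(lborel \<Otimes>\<^sub>M lborel))"
  using assms
proof (induction k arbitrary: \<phi> rule: nat_induct_at_least)
  case base
  note [measurable] = \<open>\<phi> \<in> _\<close> borel_measurable_lborel_pair[OF \<open>\<phi> \<in> _\<close>]
  interpret P: pair_sigma_finite lborel "lborel \<Otimes>\<^sub>M lborel :: (real \<times> real) measure" ..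
  have "(\<integral>\<^sup>+\<omega>. \<phi> (S 1 \<omega>, W (Suc 1) \<omega>) \<partial>M)
    = (\<integral>\<^sup>+\<omega>. (\<lambda>w. \<integral>\<^sup>+z. ennreal (step_ker (0, w) z) * \<phi> z \<partial>(lborel \<Otimes>\<^sub>M lborel)) (U 0 \<omega>) \<partial>M)"
    \<comment> \<open>The initial state is \<open>S 0 = 0\<close> and
      \<open>W 1 = U 0\<close>.\<close>
    using nn_integral_Suc[OF base, of 0] by (simp add: S_def W_def)
  also have "\<dots> = (\<integral>\<^sup>+w. ennreal (indicator {0..1} w)
      * (\<integral>\<^sup>+z. ennreal (step_ker (0, w) z) * \<phi> z \<partial>(lborel \<Otimes>\<^sub>M lborel)) \<partial>lborel)"
    by (rule distributed_nn_integral[OF U, symmetric]) measurable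
  also have "\<dots> = (\<integral>\<^sup>+w. \<integral>\<^sup>+z. ennreal (indicator {0..1} w) * (ennreal (step_ker (0, w) z) * \<phi> z)
      \<partial>(lborel \<Otimes>\<^sub>M lborel) \<partial>lborel)"
    by (intro nn_integral_cong nn_integral_cmult[symmetric] borel_measurable_lborel_pair) measurable
  also have "\<dots> = (\<integral>\<^sup>+z. \<integral>\<^sup>+w. ennreal (indicator {0..1} w) * (ennreal (step_ker (0, w) z) * \<phi> z)
      \<partial>lborel \<partial>(lborel \<Otimes>\<^sub>M lborel))"
    by (rule P.Fubini'[symmetric]) measurable
  also have "\<dots> = (\<integral>\<^sup>+z. \<integral>\<^sup>+w. \<phi> z * (ennreal (step_ker (0, w) z) * indicator {0..1} w)
      \<partial>lborel \<partial>(lborel \<Otimes>\<^sub>M lborel))"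
    by (simp add: mult_ac ennreal_indicator)
  also have "\<dots> = (\<integral>\<^sup>+z. \<phi> z * ennreal (joint_dens 1 z) \<partial>(lborel \<Otimes>\<^sub>M lborel))"
    by (intro nn_integral_cong, subst nn_integral_cmult) (auto simp: nn_integral_step_ker_0)
  finally show ?case .
next
  case (Suc k)
  note [measurable] = \<open>\<phi> \<in> _\<close> borel_measurable_lborel_pair[OF \<open>\<phi> \<in> _\<close>]
  interpret P: pair_sigma_finite "lborel \<Otimes>\<^sub>M lborel :: (real \<times> real) measure"
    "lborel \<Otimes>\<^sub>M lborel :: (real \<times> real) measure" ..
  have "(\<integral>\<^sup>+\<omega>. \<phi> (S (Suc k) \<omega>, W (Suc (Suc k)) \<omega>) \<partial>M)
    = (\<integral>\<^sup>+\<omega>. \<integral>\<^sup>+z'. ennreal (step_ker (S k \<omega>, W (Suc k) \<omega>) z') * \<phi> z' \<partial>(lborel \<Otimes>\<^sub>M lborel) \<partial>M)"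
    by (rule nn_integral_Suc) fact
  also have "\<dots> = (\<integral>\<^sup>+z. (\<integral>\<^sup>+z'. ennreal (step_ker z z') * \<phi> z' \<partial>(lborel \<Otimes>\<^sub>M lborel))
      * ennreal (joint_dens k z) \<partial>(lborel \<Otimes>\<^sub>M lborel))"
    by (rule Suc.IH) measurable
  also have "\<dots> = (\<integral>\<^sup>+z. \<integral>\<^sup>+z'. ennreal (step_ker z z') * \<phi> z' * ennreal (joint_dens k z)
      \<partial>(lborel \<Otimes>\<^sub>M lborel) \<partial>(lborel \<Otimes>\<^sub>M lborel))"
    by (intro nn_integral_cong nn_integral_multc[symmetric] borel_measurable_lborel_pair
        borel_measurable_times_ennreal measurable_compose[OF step_ker_measurable_snd measurable_ennreal] Suc.prems)
  also have "\<dots> = (\<integral>\<^sup>+z'. \<integral>\<^sup>+z. ennreal (step_ker z z') * \<phi> z' * ennreal (joint_dens k z)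
      \<partial>(lborel \<Otimes>\<^sub>M lborel) \<partial>(lborel \<Otimes>\<^sub>M lborel))"
    by (rule P.Fubini'[symmetric]) measurable
  also have "\<dots> = (\<integral>\<^sup>+z'. \<integral>\<^sup>+z. \<phi> z' * (ennreal (step_ker z z') * ennreal (joint_dens k z))
      \<partial>(lborel \<Otimes>\<^sub>M lborel) \<partial>(lborel \<Otimes>\<^sub>M lborel))"
    by (simp add: mult_ac)
  also have "\<dots> = (\<integral>\<^sup>+z'. \<phi> z' * ennreal (joint_dens (Suc k) z') \<partial>(lborel \<Otimes>\<^sub>M lborel))"
    using Suc.hyps by (intro nn_integral_cong, subst nn_integral_cmult) (auto simp: nn_integral_step_ker)
  finally show ?case .
qed

text \<open>The complementary event corresponds to the region of
  \<open>nn_integral_joint_dens_region\<close>.\<close>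

lemma prob_B_var_gt:
  assumes k: "k \<ge> 1" and s: "s > 0"
  shows "prob {\<omega> \<in> space M. B_var U E k \<omega> > s} = tail_fun k s"
proof -
  let ?L = "{\<omega> \<in> space M. B_var U E k \<omega> \<le> s}"
  have [measurable]: "B_var U E k \<in> borel_measurable M"
    unfolding B_var_eq[abs_def] by measurable
  have "emeasure M ?L = (\<integral>\<^sup>+\<omega>. indicator {z. fst z * (1 - snd z) \<le> s} (S k \<omega>, W (Suc k) \<omega>) \<partial>M)"
  proof -
    have "emeasure M ?L = (\<integral>\<^sup>+\<omega>. indicator ?L \<omega> \<partial>M)"
      by (rule nn_integral_indicator[symmetric]) measurable
    also have "\<dots> = (\<integral>\<^sup>+\<omega>. indicator {z. fst z * (1 - snd z) \<le> s} (S k \<omega>, W (Suc k) \<omega>) \<partial>M)"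
      by (intro nn_integral_cong) (auto simp: B_var_eq split: split_indicator)
    finally show ?thesis .
  qed
  also have "\<dots> = (\<integral>\<^sup>+z. indicator {z. fst z * (1 - snd z) \<le> s} z * ennreal (joint_dens k z) \<partial>(lborel \<Otimes>\<^sub>M lborel))"
    by (rule joint_law[OF k]) measurable
  also have "\<dots> = ennreal (1 - tail_fun k s)"
    by (rule nn_integral_joint_dens_region[OF k s])
  finally have L: "emeasure M ?L = ennreal (1 - tail_fun k s)" .
  then have "ennreal (prob ?L) = ennreal (1 - tail_fun k s)"
    by (simp add: emeasure_eq_measure)
  \<comment> \<open>The bound \<open>tail_fun k s \<le> 1\<close> permits removing
    \<open>ennreal\<close> on both sides.\<close>
  then have "prob ?L = 1 - tail_fun k s"
    using nn_integral_tail_fun(2)[OF k s] by (simp add: ennreal_inj)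
  moreover have "prob {\<omega> \<in> space M. \<not> B_var U E k \<omega> \<le> s} = 1 - prob ?L"
    by (rule prob_neg) measurable
  ultimately show ?thesis by (simp add: not_le)
qed

end

section \<open>Return to \<open>q_fun\<close> and conclusion\<close>

lemma tail_fun_eq:
  assumes "k \<ge> 1" "s > 0"
  shows "tail_fun k s = - I2 s * integral {0..s} (\<lambda>x. x * exp x * q_fun (k - 1) x) + (\<Sum>j<k. q_fun j s)"
  unfolding tail_fun_def integral_q_fun[OF assms(2,1)] q_fun_eq[OF assms(2)] ..

theorem theorem4:
  fixes M :: "'a measure" and U E :: "nat \<Rightarrow> 'a \<Rightarrow> real" and k :: nat and s :: real
  assumes "prob_space M"
    and "\<And>j. distributed M lborel (U j) (\<lambda>x. indicator {0..1} x / measure lborel {0..(1::real)})"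
    and "\<And>j. j \<ge> 1 \<Longrightarrow> distributed M lborel (E j) (exponential_density 1)"
    and "prob_space.indep_vars M (\<lambda>_. borel)
           (\<lambda>i. case i of Inl j \<Rightarrow> U j | Inr j \<Rightarrow> E j) (range Inl \<union> Inr ` {1..})"
    and "k \<ge> 1" and "s > 0"
  shows "measure M {\<omega> \<in> space M. B_var U E k \<omega> > s}
    = - I2 s * integral {0..s} (\<lambda>\<xi>. \<xi> * exp \<xi> * q_fun (k - 1) \<xi>) + (\<Sum>j<k. q_fun j s)"
proof -
  \<comment> \<open>The uniform density in the theorem is divided by the length of the unit
    interval, which is 1.\<close>
  interpret record_process M U E
    by (rule record_process.intro[OF assms(1)], unfold_locales)
      (use assms(2-4) in \<open>simp_all add: ennreal_indicator\<close>)
  show ?thesis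
    using prob_B_var_gt tail_fun_eq assms(5,6) by simp
qed

end
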